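(* Let $G=(X\cup Y,E)$ be a bipartite graph and $\mathcal{I}$ a partition of $X$. Let $H\subseteq\mathbb{R}^{X\cup Y\cup E}$ be the polytope of all $(x,y,z)$ satisfying the following inequalities: $$0\le y_j\le 1\quad\forall j\in Y,\qquad x_i\ge 0\quad\forall i\in X,\qquad \sum_{i\in I}x_i\le 1\quad\forall I\in\mathcal{I},$$ $$z_{ij}\ge 0\quad\forall\{i,j\}\in E,\qquad x_i-z_{ij}\ge 0\quad\forall \{i,j\}\in E,$$ $$y_j-\sum_{i\in N(j)\cap I}z_{ij}\ge 0\quad\forall I\in\mathcal{I},\,j\in Y,\qquad y_j+\sum_{i\in N(j)\cap I}(x_i-z_{ij})\le 1\quad\forall I\in\mathcal{I},\,j\in Y.$$ If $G$ is subset-uniform with respect to $\mathcal{I}$ and the dependency graph $\mathcal{G}$ of $(G,\mathcal{I})$ is cycle-free (i.e. a forest), then $H=P(G,\mathcal{I})$.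
   Context: $G=(X\cup Y,E)$ is a finite bipartite graph with disjoint node sets $X,Y$; every edge $\{i,j\}\in E$ has $i\in X$, $j\in Y$. $\mathcal{I}$ is a partition of $X$ into non-empty subsets. $N(v)$ is the set of neighbours of node $v$. Vectors in $\mathbb{R}^{X\cup Y\cup E}$ are written $(x,y,z)$ with $x\in\mathbb{R}^X$, $y\in\mathbb{R}^Y$, $z\in\mathbb{R}^E$, the component of $z$ for $\{i,j\}\in E$ being $z_{ij}$. Put $X^{\mathcal{I}}=\{x\in\{0,1\}^X : \sum_{i\in I}x_i\le 1\ \forall I\in\mathcal{I}\}$ and $$P(G,\mathcal{I})=\operatorname{conv}\{(x,y,z)\in\{0,1\}^{X\cup Y\cup E} : x_iy_j=z_{ij}\ \forall\{i,j\}\in E,\ x\in X^{\mathcal{I}}\}.$$ $G$ is subset-uniform with respect to $\mathcal{I}$ if any two nodes of $X$ lying in the same subset $I\in\mathcal{I}$ have the same neighbourhood in $Y$. For such $G$, the dependency graph is $\mathcal{G}=(\mathcal{I}\cup Y,\mathcal{E})$, where $\{I,j\}\in\mathcal{E}$ iff $j$ belongs to the common neighbourhood of the nodes in $I$. *)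

theory Defs
  imports "HOL-Analysis.Analysis" "HOL-Library.Disjoint_Sets"
begin

text \<open>A graph is a pair of a node set and a set of two-element edges. Since a cycle has at least
  three nodes, traversing a single edge back and forth is not a cycle.\<close>

definition is_cycle :: "'a set \<times> 'a set set \<Rightarrow> 'a list \<Rightarrow> bool" where
  "is_cycle G vs \<longleftrightarrow>
     3 \<le> length vs \<and> distinct vs \<and> set vs \<subseteq> fst G \<and>
     (\<forall>k<length vs. {vs ! k, vs ! (Suc k mod length vs)} \<in> snd G)"

definition cycle_free :: "'a set \<times> 'a set set \<Rightarrow> bool" where
  "cycle_free G \<longleftrightarrow> (\<nexists>vs. is_cycle G vs)"

definition bipartite_graph :: "'v set \<Rightarrow> 'v set \<Rightarrow> 'v set set \<Rightarrow> bool" where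
  "bipartite_graph X Y E \<longleftrightarrow>
     finite X \<and> finite Y \<and> X \<inter> Y = {} \<and> E \<subseteq> {{i, j} | i j. i \<in> X \<and> j \<in> Y}"

definition nbrs :: "'v set set \<Rightarrow> 'v \<Rightarrow> 'v set" where
  "nbrs E v = {w. {v, w} \<in> E}"

definition subset_uniform :: "'v set set \<Rightarrow> 'v set set \<Rightarrow> bool" where
  "subset_uniform E \<I> \<longleftrightarrow> (\<forall>I\<in>\<I>. \<forall>i\<in>I. \<forall>i'\<in>I. nbrs E i = nbrs E i')"

text \<open>The nodes are the disjoint union of \<open>\<I>\<close> and \<open>Y\<close>. The definition makes sense without
  subset-uniformity; for subset-uniform graphs and non-empty \<open>I\<close> the condition on \<open>{Inl I, Inr j}\<close>
  says that \<open>j\<close> is in the common value of \<open>nbrs E i\<close> for \<open>i \<in> I\<close>.\<close>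

definition dependency_graph ::
  "'v set \<Rightarrow> 'v set set \<Rightarrow> 'v set set \<Rightarrow> ('v set + 'v) set \<times> ('v set + 'v) set set" where
  "dependency_graph Y E \<I> =
     (Inl ` \<I> \<union> Inr ` Y,
      {{Inl I, Inr j} | I j. I \<in> \<I> \<and> j \<in> Y \<and> (\<forall>i\<in>I. j \<in> nbrs E i)})"

text \<open>
  For a finite index type and a subset \<open>S\<close> of it, the space of real vectors indexed by \<open>S\<close> is
  identified with the coordinate subspace of vectors vanishing outside \<open>S\<close>. A vector indexed by
  the disjoint union of \<open>X\<close>, \<open>Y\<close> and \<open>E\<close> is a triple \<open>(x, y, z)\<close> of such vectors; the component
  of \<open>z\<close> at an edge is indexed by the edge itself, that is, by the two-element set \<open>{i, j}\<close>.
\<close>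

definition vectors_on :: "'n::finite set \<Rightarrow> (real ^ 'n) set" where
  "vectors_on S = {v. \<forall>k. k \<notin> S \<longrightarrow> v $ k = 0}"

definition binary_on :: "'n::finite set \<Rightarrow> (real ^ 'n) set" where
  "binary_on S = {v \<in> vectors_on S. \<forall>k\<in>S. v $ k \<in> {0, 1}}"

definition multiple_choice :: "'v::finite set \<Rightarrow> 'v set set \<Rightarrow> (real ^ 'v) set" where
  "multiple_choice X \<I> = {x \<in> binary_on X. \<forall>I\<in>\<I>. (\<Sum>i\<in>I. x $ i) \<le> 1}"

definition P_polytope ::
  "'v::finite set \<Rightarrow> 'v set \<Rightarrow> 'v set set \<Rightarrow> 'v set set
     \<Rightarrow> ((real ^ 'v) \<times> (real ^ 'v) \<times> (real ^ 'v set)) set" where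
  "P_polytope X Y E \<I> = convex hull
     {(x, y, z). x \<in> binary_on X \<and> y \<in> binary_on Y \<and> z \<in> binary_on E \<and>
        (\<forall>i\<in>X. \<forall>j\<in>Y. {i, j} \<in> E \<longrightarrow> x $ i * y $ j = z $ {i, j}) \<and>
        x \<in> multiple_choice X \<I>}"

definition H_polytope ::
  "'v::finite set \<Rightarrow> 'v set \<Rightarrow> 'v set set \<Rightarrow> 'v set set
     \<Rightarrow> ((real ^ 'v) \<times> (real ^ 'v) \<times> (real ^ 'v set)) set" where
  "H_polytope X Y E \<I> =
     {(x, y, z). x \<in> vectors_on X \<and> y \<in> vectors_on Y \<and> z \<in> vectors_on E \<and>
        (\<forall>j\<in>Y. 0 \<le> y $ j \<and> y $ j \<le> 1) \<and>
        (\<forall>i\<in>X. x $ i \<ge> 0) \<and>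
        (\<forall>I\<in>\<I>. (\<Sum>i\<in>I. x $ i) \<le> 1) \<and>
        (\<forall>i\<in>X. \<forall>j\<in>Y. {i, j} \<in> E \<longrightarrow> z $ {i, j} \<ge> 0) \<and>
        (\<forall>i\<in>X. \<forall>j\<in>Y. {i, j} \<in> E \<longrightarrow> x $ i - z $ {i, j} \<ge> 0) \<and>
        (\<forall>I\<in>\<I>. \<forall>j\<in>Y. y $ j - (\<Sum>i\<in>nbrs E j \<inter> I. z $ {i, j}) \<ge> 0) \<and>
        (\<forall>I\<in>\<I>. \<forall>j\<in>Y. y $ j + (\<Sum>i\<in>nbrs E j \<inter> I. (x $ i - z $ {i, j})) \<le> 1)}"

end

theory Submission
  imports Defs "HOL-Probability.Probability_Mass_Function"
begin

text \<open>
  A point \<open>(x, y, z)\<close> of \<open>H\<close> prescribes, for every node of the dependency graph, a probability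
  distribution: for \<open>I\<close>, choose \<open>i \<in> I\<close> with probability \<open>x\<^sub>i\<close> or nothing; for \<open>j\<close>, choose \<open>j\<close>
  with probability \<open>y\<^sub>j\<close> or nothing. The inequalities say precisely that for every edge \<open>{I, j}\<close>
  the numbers \<open>z\<^sub>i\<^sub>j\<close> extend to a joint distribution with these two marginals. On a forest,
  consistent pairwise distributions can be glued to one distribution of all choices by adding
  leaves one at a time, and \<open>(x, y, z)\<close> is its expected value, a convex combination of vertices.
\<close>

section \<open>Leaves of forests\<close>

lemma cycle_free_subset:
  assumes "cycle_free (V, E)" "W \<subseteq> V"
  shows "cycle_free (W, E)"
  using assms unfolding cycle_free_def is_cycle_def by auto

text \<open>The first node of a longest path serves as \<open>w\<close>: a neighbour off the path
  would prolong it at the front, and one at position 2 or later would close a cycle. The leaf may be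
  isolated, so only uniqueness of its neighbour is claimed. Loops are excluded separately because
  \<open>is_cycle\<close> asks for at least three nodes.\<close>

lemma cycle_free_leaf:
  assumes fin: "finite V" and ne: "V \<noteq> {}" and cf: "cycle_free (V, E)"
    and loopfree: "\<And>v. {v, v} \<notin> E"
  obtains w where "w \<in> V" "\<And>u u'. u \<in> V \<Longrightarrow> u' \<in> V \<Longrightarrow> {w, u} \<in> E \<Longrightarrow> {w, u'} \<in> E \<Longrightarrow> u = u'"
proof -
  define path where "path = (\<lambda>p. p \<noteq> [] \<and> distinct p \<and> set p \<subseteq> V \<and>
      (\<forall>k. Suc k < length p \<longrightarrow> {p ! k, p ! Suc k} \<in> E))"
  from ne obtain v where "v \<in> V" by auto
  then have "path [v]" by (simp add: path_def)
  moreover have "length p < Suc (card V)" if "path p" for p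
    using that distinct_card[of p] card_mono[OF fin, of "set p"] by (simp add: path_def)
  ultimately obtain p where p: "path p" and maximal: "\<And>q. path q \<Longrightarrow> length q \<le> length p"
    using ex_has_greatest_nat[of path "[v]" length "Suc (card V)"] by (metis less_or_eq_imp_le)
  define w where "w = p ! 0"
  have len: "0 < length p" using p by (simp add: path_def)
  have second: "1 < length p \<and> u = p ! 1" if u: "u \<in> V" "{w, u} \<in> E" for u
  proof -
    have "u \<in> set p"
    proof (rule ccontr)
      assume "u \<notin> set p"
      then have "path (u # p)"
        using p u len unfolding path_def w_def
        by (auto simp: nth_Cons insert_commute split: nat.splits)
      from maximal[OF this] show False by simp
    qed
    then obtain k where k: "k < length p" "p ! k = u" by (metis in_set_conv_nth)
    have "k \<noteq> 0" using k u loopfree by (metis w_def)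
    moreover have "\<not> 2 \<le> k"
    proof
      assume k2: "2 \<le> k"
      \<comment> \<open>The prefix ending at \<open>u\<close> is the cycle: at \<open>i = k\<close>
        the successor index wraps to 0, and the required edge is the one joining \<open>u\<close>
        back to \<open>w\<close>.\<close>
      have "{take (Suc k) p ! i, take (Suc k) p ! (Suc i mod Suc k)} \<in> E" if "i < Suc k" for i
      proof (cases "i = k")
        case True
        then show ?thesis using k u by (simp add: w_def insert_commute)
      next
        case False
        then show ?thesis using that p k by (simp add: path_def)
      qed
      moreover have "set (take (Suc k) p) \<subseteq> V" using p set_take_subset[of "Suc k" p]
        unfolding path_def by blast
      ultimately have "is_cycle (V, E) (take (Suc k) p)"
        using p k k2 unfolding is_cycle_def path_def
        by (simp add: min_absorb1 Suc_leI del: nth_take)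
      then show False using cf by (auto simp: cycle_free_def)
    qed
    ultimately have "k = 1" by linarith
    then show ?thesis using k by auto
  qed
  show thesis
  proof
    show "w \<in> V" using p len by (auto simp: path_def w_def)
    show "u = u'" if "u \<in> V" "u' \<in> V" "{w, u} \<in> E" "{w, u'} \<in> E" for u u'
      using second that by blast
  qed
qed

section \<open>Gluing distributions along a forest\<close>

text \<open>The law of \<open>f u\<close> is the first marginal of \<open>q\<close>, so
  \<open>\<mu>\<close> and \<open>q\<close> can be coupled with \<open>f u\<close> equal to the
  first component; overwriting \<open>f\<close> at \<open>w\<close> by the second component gives
  \<open>\<nu>\<close>. Every statistic that ignores the value at \<open>w\<close> keeps its law, so
  all that was arranged on the other nodes survives.\<close>

lemma pmf_extend_by_node:
  fixes \<mu> :: "('n \<Rightarrow> 's) pmf" and q :: "('s \<times> 's) pmf"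
  assumes "map_pmf (\<lambda>f. f u) \<mu> = map_pmf fst q" and "u \<noteq> w"
  obtains \<nu> where "map_pmf (\<lambda>f. (f u, f w)) \<nu> = q"
    and "\<And>g :: ('n \<Rightarrow> 's) \<Rightarrow> 'b. (\<And>f t. g (f(w := t)) = g f) \<Longrightarrow> map_pmf g \<nu> = map_pmf g \<mu>"
proof -
  \<comment> \<open>Equality of the two image distributions, read as \<open>rel_pmf\<close> of an
    equality, is the existence of such a coupling.\<close>
  have "rel_pmf (\<lambda>f st. f u = fst st) \<mu> q"
    using assms(1) by (simp add: pmf.rel_eq[symmetric] pmf.rel_map)
  then obtain C where C: "\<And>f st. (f, st) \<in> set_pmf C \<Longrightarrow> f u = fst st"
      and marg: "map_pmf fst C = \<mu>" "map_pmf snd C = q"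
    by (fastforce simp: rel_pmf.simps)
  define \<nu> where "\<nu> = map_pmf (\<lambda>(f, st). f(w := snd st)) C"
  show thesis
  proof
    have "map_pmf (\<lambda>f. (f u, f w)) \<nu> = map_pmf snd C"
      unfolding \<nu>_def pmf.map_comp using C assms(2)
      by (intro map_pmf_cong) (auto simp: prod_eq_iff)
    then show "map_pmf (\<lambda>f. (f u, f w)) \<nu> = q" by (simp add: marg)
    show "map_pmf g \<nu> = map_pmf g \<mu>" if "\<And>f t. g (f(w := t)) = g f" for g :: "('n \<Rightarrow> 's) \<Rightarrow> 'b"
    proof -
      have "map_pmf g \<nu> = map_pmf g (map_pmf fst C)"
        unfolding \<nu>_def pmf.map_comp using that by (intro map_pmf_cong) auto
      then show ?thesis by (simp add: marg)
    qed
  qed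
qed

text \<open>Induction on the node set, removing a leaf \<open>w\<close> and putting it back;
  \<open>E\<close> stays fixed and only \<open>V\<close> shrinks. Edges are unordered, so
  \<open>swap_q\<close> makes \<open>q u v\<close> and \<open>q v u\<close> one distribution read in
  two orders, and \<open>fst_q\<close>, applied in both orders, controls both marginals.\<close>

lemma forest_joint_pmf:
  fixes p :: "'n \<Rightarrow> 's pmf" and q :: "'n \<Rightarrow> 'n \<Rightarrow> ('s \<times> 's) pmf"
  assumes "finite V" and "cycle_free (V, E)" and loopfree: "\<And>v. {v, v} \<notin> E"
    and fst_q: "\<And>u v. {u, v} \<in> E \<Longrightarrow> map_pmf fst (q u v) = p u"
    and swap_q: "\<And>u v. {u, v} \<in> E \<Longrightarrow> q v u = map_pmf prod.swap (q u v)"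
  shows "\<exists>\<mu> :: ('n \<Rightarrow> 's) pmf. (\<forall>v\<in>V. map_pmf (\<lambda>f. f v) \<mu> = p v) \<and>
           (\<forall>u\<in>V. \<forall>v\<in>V. {u, v} \<in> E \<longrightarrow> map_pmf (\<lambda>f. (f u, f v)) \<mu> = q u v)"
  using assms(1,2)
proof (induction V rule: finite_psubset_induct)
  case (psubset V)
  show ?case
  proof (cases "V = {}")
    case True
    then show ?thesis by simp
  next
    case False
    then obtain w where w: "w \<in> V"
        and leaf: "\<And>u u'. u \<in> V \<Longrightarrow> u' \<in> V \<Longrightarrow> {w, u} \<in> E \<Longrightarrow> {w, u'} \<in> E \<Longrightarrow> u = u'"
      using cycle_free_leaf[OF psubset.hyps _ psubset.prems loopfree] by metis
    have "V - {w} \<subset> V" using w by auto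
    from psubset.IH[OF this cycle_free_subset[OF psubset.prems]]
    obtain \<mu> :: "('n \<Rightarrow> 's) pmf" where
        \<mu>1: "\<And>v. v \<in> V - {w} \<Longrightarrow> map_pmf (\<lambda>f. f v) \<mu> = p v"
      and \<mu>2: "\<And>u v. u \<in> V - {w} \<Longrightarrow> v \<in> V - {w} \<Longrightarrow> {u, v} \<in> E \<Longrightarrow>
                 map_pmf (\<lambda>f. (f u, f v)) \<mu> = q u v"
      by auto
    show ?thesis
    proof (cases "\<exists>u\<in>V. {w, u} \<in> E")
      case False
      \<comment> \<open>An isolated \<open>w\<close> is drawn independently of all other
        nodes.\<close>
      define \<nu> where "\<nu> = map_pmf (\<lambda>(f, t). f(w := t)) (pair_pmf \<mu> (p w))"
      have old: "map_pmf g \<nu> = map_pmf g \<mu>" if "\<And>f t. g (f(w := t)) = g f"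
        for g :: "('n \<Rightarrow> 's) \<Rightarrow> 'b"
      proof -
        have "map_pmf g \<nu> = map_pmf g (map_pmf fst (pair_pmf \<mu> (p w)))"
          unfolding \<nu>_def pmf.map_comp using that by (intro map_pmf_cong) auto
        then show ?thesis by (simp add: map_fst_pair_pmf)
      qed
      have "map_pmf (\<lambda>f. f w) \<nu> = map_pmf snd (pair_pmf \<mu> (p w))"
        unfolding \<nu>_def pmf.map_comp by (intro map_pmf_cong) auto
      then have new: "map_pmf (\<lambda>f. f w) \<nu> = p w" by (simp add: map_snd_pair_pmf)
      have "map_pmf (\<lambda>f. f v) \<nu> = p v" if "v \<in> V" for v
        using new that \<mu>1[of v] old[of "\<lambda>f. f v"] by (cases "v = w") auto
      moreover have "map_pmf (\<lambda>f. (f u, f v)) \<nu> = q u v"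
        if "u \<in> V" "v \<in> V" "{u, v} \<in> E" for u v
      proof -
        have "u \<noteq> w" "v \<noteq> w" using False that by (auto simp: insert_commute)
        then show ?thesis using that \<mu>2[of u v] old[of "\<lambda>f. (f u, f v)"] by auto
      qed
      ultimately show ?thesis by blast
    next
      case True
      then obtain u where u: "u \<in> V" "{w, u} \<in> E" by auto
      then have uw: "u \<noteq> w" "{u, w} \<in> E" using loopfree by (auto simp: insert_commute)
      have "map_pmf (\<lambda>f. f u) \<mu> = map_pmf fst (q u w)"
        using \<mu>1[of u] u uw fst_q[of u w] by simp
      from this uw(1) obtain \<nu> where \<nu>: "map_pmf (\<lambda>f. (f u, f w)) \<nu> = q u w"
        and old: "\<And>g :: ('n \<Rightarrow> 's) \<Rightarrow> 's \<times> 's. (\<And>f t. g (f(w := t)) = g f) \<Longrightarrow>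
                    map_pmf g \<nu> = map_pmf g \<mu>"
        by (rule pmf_extend_by_node) blast
      have \<nu>': "map_pmf (\<lambda>f. (f w, f u)) \<nu> = q w u"
        using swap_q[OF uw(2)] by (simp add: \<nu>[symmetric] pmf.map_comp o_def)
      have "map_pmf (\<lambda>f. f v) \<nu> = p v" if "v \<in> V" for v
      proof (cases "v = w")
        case True
        have "map_pmf (\<lambda>f. f w) \<nu> = map_pmf fst (map_pmf (\<lambda>f. (f w, f u)) \<nu>)"
          by (simp add: pmf.map_comp o_def)
        also have "\<dots> = p w" using \<nu>' fst_q[OF u(2)] by simp
        finally show ?thesis using True by simp
      next
        case False
        \<comment> \<open>Here \<open>old\<close> is available only for maps into pairs, so the
          marginal at \<open>v\<close> is read off from the doubled pair
          \<open>(f v, f v)\<close>.\<close>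
        have "map_pmf (\<lambda>f. f v) \<nu> = map_pmf fst (map_pmf (\<lambda>f. (f v, f v)) \<nu>)"
          by (simp add: pmf.map_comp o_def)
        also have "\<dots> = map_pmf fst (map_pmf (\<lambda>f. (f v, f v)) \<mu>)"
          using False by (subst old) auto
        also have "\<dots> = p v" using \<mu>1[of v] that False by (simp add: pmf.map_comp o_def)
        finally show ?thesis .
      qed
      moreover have "map_pmf (\<lambda>f. (f a, f b)) \<nu> = q a b"
        if ab: "a \<in> V" "b \<in> V" "{a, b} \<in> E" for a b
      proof -
        consider "a = w" | "b = w" | "a \<noteq> w" "b \<noteq> w" by blast
        then show ?thesis
        proof cases
          case 1
          then have "b = u" using leaf[of b u] ab u by auto
          then show ?thesis using 1 \<nu>' by simp
        next
          case 2
          then have "a = u" using leaf[of a u] ab u by (auto simp: insert_commute)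
          then show ?thesis using 2 \<nu> by simp
        next
          case 3
          then show ?thesis using ab \<mu>2[of a b] old[of "\<lambda>f. (f a, f b)"] by auto
        qed
      qed
      ultimately show ?thesis by blast
    qed
  qed
qed

section \<open>Distributions on finite types\<close>

lemma ex_pmf_finite:
  fixes h :: "'a::finite \<Rightarrow> real"
  assumes "\<And>a. 0 \<le> h a" "sum h UNIV = 1"
  obtains p where "\<And>a. pmf p a = h a"
proof -
  have "(\<integral>\<^sup>+ a. ennreal (h a) \<partial>count_space UNIV) = 1"
    using assms by (simp add: nn_integral_count_space_finite sum_ennreal)
  then show thesis using that pmf_embed_pmf[of h] assms(1) by blast
qed

lemma sum_UNIV_option:
  fixes h :: "'a::finite option \<Rightarrow> 'b::comm_monoid_add"
  shows "sum h UNIV = h None + (\<Sum>i\<in>UNIV. h (Some i))"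
  by (simp add: UNIV_option_conv sum.reindex)

lemma sum_UNIV_prod:
  fixes h :: "'a::finite \<times> 'b::finite \<Rightarrow> 'c::comm_monoid_add"
  shows "sum h UNIV = (\<Sum>a\<in>UNIV. \<Sum>b\<in>UNIV. h (a, b))"
  by (simp add: sum.cartesian_product flip: UNIV_Times_UNIV)

lemma pmf_map_fst_finite:
  fixes q :: "('a::finite \<times> 'b::finite) pmf"
  shows "pmf (map_pmf fst q) a = (\<Sum>b\<in>UNIV. pmf q (a, b))"
proof -
  have "fst -` {a} = Pair a ` (UNIV :: 'b set)" by auto
  then show ?thesis
    by (simp add: pmf_map measure_measure_pmf_finite sum.reindex inj_on_def)
qed

lemma pmf_map_snd_finite:
  fixes q :: "('a::finite \<times> 'b::finite) pmf"
  shows "pmf (map_pmf snd q) b = (\<Sum>a\<in>UNIV. pmf q (a, b))"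
proof -
  have "snd -` {b} = (\<lambda>a. (a, b)) ` (UNIV :: 'a set)" by auto
  then show ?thesis
    by (simp add: pmf_map measure_measure_pmf_finite sum.reindex inj_on_def)
qed

lemma sum_pmf_of_bool:
  fixes p :: "'a::finite pmf"
  shows "(\<Sum>a\<in>UNIV. pmf p a * of_bool (P a)) = measure p {a. P a}"
  by (simp add: measure_measure_pmf_finite sum.inter_filter[symmetric] of_bool_def
      if_distrib cong: if_cong)

lemma ex_pmf_option:
  fixes a :: "'v::finite \<Rightarrow> real"
  assumes "\<And>i. 0 \<le> a i" "sum a UNIV \<le> 1"
  obtains p where "\<And>i. pmf p (Some i) = a i" "pmf p None = 1 - sum a UNIV"
proof -
  define h where "h = case_option (1 - sum a UNIV) a"
  have "0 \<le> h s" for s using assms by (simp add: h_def split: option.splits)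
  moreover have "sum h UNIV = 1" by (simp add: sum_UNIV_option h_def)
  ultimately obtain p where "\<And>s. pmf p s = h s" using ex_pmf_finite by blast
  then show thesis using that[of p] by (simp add: h_def)
qed

text \<open>Prescribing the entries \<open>c i\<close> at \<open>(Some i, Some j)\<close> leaves no
  freedom: the marginals force \<open>a i - c i\<close> beside them, \<open>b - sum c UNIV\<close>
  below them and the remaining mass at \<open>(None, None)\<close>. Nonnegativity of these four
  kinds of entries is exactly the four inequalities assumed, which are those of \<open>H\<close>
  linking \<open>x\<close>, \<open>y\<close> and \<open>z\<close>.\<close>

lemma ex_joint_pmf:
  fixes a c :: "'v::finite \<Rightarrow> real" and j :: "'w::finite"
  assumes c: "\<And>i. 0 \<le> c i" "\<And>i. c i \<le> a i"
    and b: "sum c UNIV \<le> b" "b + (\<Sum>i\<in>UNIV. a i - c i) \<le> 1"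
    and p: "\<And>i. pmf p (Some i) = a i" "pmf p None = 1 - sum a UNIV"
    and r: "\<And>k. pmf r (Some k) = (if k = j then b else 0)" "pmf r None = 1 - b"
  obtains q where "map_pmf fst q = p" "map_pmf snd q = r" "\<And>i. pmf q (Some i, Some j) = c i"
proof -
  define h where "h = (\<lambda>(s, t). case s of
      None \<Rightarrow> (case t of None \<Rightarrow> 1 - b - (\<Sum>i\<in>UNIV. a i - c i)
                       | Some k \<Rightarrow> if k = j then b - sum c UNIV else 0)
    | Some i \<Rightarrow> (case t of None \<Rightarrow> a i - c i | Some k \<Rightarrow> if k = j then c i else 0))"
  have "0 \<le> h st" for st
    using c b by (cases st; cases "fst st"; cases "snd st") (auto simp: h_def)
  moreover have "sum h UNIV = 1"
    by (simp add: sum_UNIV_prod sum_UNIV_option h_def sum.distrib sum_subtractf)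
  ultimately obtain q where q: "\<And>st. pmf q st = h st" using ex_pmf_finite by blast
  show thesis
  proof
    show "map_pmf fst q = p"
    proof (rule pmf_eqI)
      show "pmf (map_pmf fst q) s = pmf p s" for s
        by (cases s) (simp_all add: pmf_map_fst_finite q h_def sum_UNIV_option p sum_subtractf)
    qed
    show "map_pmf snd q = r"
    proof (rule pmf_eqI)
      show "pmf (map_pmf snd q) t = pmf r t" for t
        by (cases t) (simp_all add: pmf_map_snd_finite q h_def sum_UNIV_option r)
    qed
    show "pmf q (Some i, Some j) = c i" for i by (simp add: q h_def)
  qed
qed

section \<open>The two inclusions\<close>

lemma convex_H_polytope: "convex (H_polytope X Y E \<I>)"
proof (rule convexI)
  fix p p' and s t :: real
  assume p: "p \<in> H_polytope X Y E \<I>" "p' \<in> H_polytope X Y E \<I>" and st: "0 \<le> s" "0 \<le> t" "s + t = 1"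
  obtain x y z x' y' z' where pe: "p = (x, y, z)" "p' = (x', y', z')"
    by (metis prod_cases3)
  \<comment> \<open>The three rules bring every constraint at the combined point into the form
    \<open>s * A + t * B\<close>, with \<open>A\<close> and \<open>B\<close> the same expression at
    the two given points. Removing \<open>diff_ge_0_iff_ge\<close> from the simpset below keeps
    differences intact for \<open>diff\<close>.\<close>
  have lin: "(\<Sum>i\<in>A. s * f i + t * g i) = s * sum f A + t * sum g A" for A f and g :: "'b \<Rightarrow> real"
    by (simp add: sum.distrib sum_distrib_left)
  have diff: "s * \<alpha> + t * \<beta> - (s * \<gamma> + t * \<delta>) = s * (\<alpha> - \<gamma>) + t * (\<beta> - \<delta>)" for \<alpha> \<beta> \<gamma> \<delta> :: real
    by (simp add: algebra_simps)
  have add: "s * \<alpha> + t * \<beta> + (s * \<gamma> + t * \<delta>) = s * (\<alpha> + \<gamma>) + t * (\<beta> + \<delta>)" for \<alpha> \<beta> \<gamma> \<delta> :: real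
    by (simp add: algebra_simps)
  show "s *\<^sub>R p + t *\<^sub>R p' \<in> H_polytope X Y E \<I>"
    using p st unfolding pe H_polytope_def vectors_on_def
    by (auto simp: lin diff add simp del: diff_ge_0_iff_ge
        intro!: convex_bound_le add_nonneg_nonneg mult_nonneg_nonneg)
qed

text \<open>As \<open>H\<close> is convex, only the generating 0/1 points matter. There the sum of
  \<open>z\<close> over a block factors as \<open>S * y $ j\<close>, where \<open>S \<le> 1\<close>
  is the sum of \<open>x\<close> over the neighbours of \<open>j\<close> in the block. Multiplying
  \<open>S \<le> 1\<close> by \<open>y $ j\<close> and by \<open>1 - y $ j\<close> gives the last
  two families of inequalities.\<close>

lemma P_polytope_subset_H_polytope:
  fixes X Y :: "'v::finite set"
  assumes "partition_on X \<I>"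
  shows "P_polytope X Y E \<I> \<subseteq> H_polytope X Y E \<I>"
  unfolding P_polytope_def
proof (intro hull_minimal subsetI convex_H_polytope, clarify)
  fix x y :: "real ^ 'v" and z :: "real ^ 'v set"
  assume x: "x \<in> binary_on X" and y: "y \<in> binary_on Y" and z: "z \<in> binary_on E"
    and prod: "\<forall>i\<in>X. \<forall>j\<in>Y. {i, j} \<in> E \<longrightarrow> x $ i * y $ j = z $ {i, j}"
    and mc: "x \<in> multiple_choice X \<I>"
  have x01: "0 \<le> x $ i \<and> x $ i \<le> 1" for i
    using x by (cases "i \<in> X") (auto simp: binary_on_def vectors_on_def)
  have y01: "0 \<le> y $ j \<and> y $ j \<le> 1" for j
    using y by (cases "j \<in> Y") (auto simp: binary_on_def vectors_on_def)
  have IX: "I \<subseteq> X" if "I \<in> \<I>" for I using that assms by (auto simp: partition_on_def)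
  have z_eq: "z $ {i, j} = x $ i * y $ j" if "i \<in> X" "j \<in> Y" "{i, j} \<in> E" for i j
    using prod that by simp
  have le1: "(\<Sum>i\<in>nbrs E j \<inter> I. x $ i) \<le> 1" if "I \<in> \<I>" for I j
  proof -
    have "(\<Sum>i\<in>nbrs E j \<inter> I. x $ i) \<le> (\<Sum>i\<in>I. x $ i)"
      using x01 by (intro sum_mono2) auto
    also have "\<dots> \<le> 1" using mc that by (simp add: multiple_choice_def)
    finally show ?thesis .
  qed
  have sum_z: "(\<Sum>i\<in>nbrs E j \<inter> I. z $ {i, j}) = (\<Sum>i\<in>nbrs E j \<inter> I. x $ i) * y $ j"
    if "I \<in> \<I>" "j \<in> Y" for I j
    unfolding sum_distrib_right
    using that IX by (intro sum.cong) (auto simp: nbrs_def insert_commute intro!: z_eq)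
  have "(\<Sum>i\<in>nbrs E j \<inter> I. z $ {i, j}) \<le> y $ j" if "I \<in> \<I>" "j \<in> Y" for I j
    using mult_right_mono[OF le1[OF that(1), of j], of "y $ j"] y01[of j]
    by (simp add: sum_z that)
  moreover have "y $ j + (\<Sum>i\<in>nbrs E j \<inter> I. x $ i - z $ {i, j}) \<le> 1"
    if "I \<in> \<I>" "j \<in> Y" for I j
    using mult_right_mono[OF le1[OF that(1), of j], of "1 - y $ j"] y01[of j]
    by (simp add: sum_subtractf sum_z that algebra_simps)
  moreover have "(\<Sum>i\<in>I. x $ i) \<le> 1" if "I \<in> \<I>" for I
    using mc that by (simp add: multiple_choice_def)
  moreover have "x $ i * y $ j \<le> x $ i" for i j
    using mult_left_mono[of "y $ j" 1 "x $ i"] x01 y01 by simp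
  ultimately show "(x, y, z) \<in> H_polytope X Y E \<I>"
    using x y z x01 y01 by (simp add: H_polytope_def binary_on_def z_eq)
qed

text \<open>Cycle-freeness permits the gluing; subset-uniformity places every edge
  \<open>{i, j}\<close> of the graph over an edge of the dependency graph, so that each component of
  \<open>z\<close> is governed by one of the glued pair distributions.\<close>

lemma H_polytope_subset_P_polytope:
  fixes X Y :: "'v::finite set" and E \<I> :: "'v set set"
  assumes bip: "bipartite_graph X Y E"
    and part: "partition_on X \<I>"
    and unif: "subset_uniform E \<I>"
    and forest: "cycle_free (dependency_graph Y E \<I>)"
  shows "H_polytope X Y E \<I> \<subseteq> P_polytope X Y E \<I>"
proof clarify
  fix x y :: "real ^ 'v" and z :: "real ^ 'v set"
  assume "(x, y, z) \<in> H_polytope X Y E \<I>"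
  then have supp: "\<And>i. i \<notin> X \<Longrightarrow> x $ i = 0" "\<And>j. j \<notin> Y \<Longrightarrow> y $ j = 0" "\<And>e. e \<notin> E \<Longrightarrow> z $ e = 0"
    and y01: "\<And>j. j \<in> Y \<Longrightarrow> 0 \<le> y $ j" "\<And>j. j \<in> Y \<Longrightarrow> y $ j \<le> 1"
    and x0: "\<And>i. i \<in> X \<Longrightarrow> 0 \<le> x $ i"
    and x1: "\<And>I. I \<in> \<I> \<Longrightarrow> (\<Sum>i\<in>I. x $ i) \<le> 1"
    and z0: "\<And>i j. i \<in> X \<Longrightarrow> j \<in> Y \<Longrightarrow> {i, j} \<in> E \<Longrightarrow> 0 \<le> z $ {i, j}"
    and zx: "\<And>i j. i \<in> X \<Longrightarrow> j \<in> Y \<Longrightarrow> {i, j} \<in> E \<Longrightarrow> z $ {i, j} \<le> x $ i"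
    and zy: "\<And>I j. I \<in> \<I> \<Longrightarrow> j \<in> Y \<Longrightarrow> (\<Sum>i\<in>nbrs E j \<inter> I. z $ {i, j}) \<le> y $ j"
    and xyz: "\<And>I j. I \<in> \<I> \<Longrightarrow> j \<in> Y \<Longrightarrow>
                y $ j + (\<Sum>i\<in>nbrs E j \<inter> I. x $ i - z $ {i, j}) \<le> 1"
    by (auto simp: H_polytope_def vectors_on_def)
  have disj: "X \<inter> Y = {}" and edges: "\<And>e. e \<in> E \<Longrightarrow> \<exists>i\<in>X. \<exists>j\<in>Y. e = {i, j}"
    using bip unfolding bipartite_graph_def by blast+
  have IX: "I \<subseteq> X" if "I \<in> \<I>" for I using that part by (auto simp: partition_on_def)
  have block: "\<exists>I\<in>\<I>. i \<in> I" if "i \<in> X" for i using that part by (auto simp: partition_on_def)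
  have block_unique: "I = J" if "I \<in> \<I>" "J \<in> \<I>" "i \<in> I" "i \<in> J" for I J i
    using that part by (auto simp: partition_on_def disjoint_def)

  define D where "D = {{Inl I, Inr j} | I j. I \<in> \<I> \<and> j \<in> Y \<and> (\<forall>i\<in>I. j \<in> nbrs E i)}"
  define V where "V = (Inl ` \<I> \<union> Inr ` Y :: ('v set + 'v) set)"
  have D_cases: "\<exists>I j. I \<in> \<I> \<and> j \<in> Y \<and> (\<forall>i\<in>I. j \<in> nbrs E i) \<and>
      (u = Inl I \<and> v = Inr j \<or> u = Inr j \<and> v = Inl I)" if "{u, v} \<in> D" for u v
    using that unfolding D_def mem_Collect_eq doubleton_eq_iff by metis
  have cf: "cycle_free (V, D)" using forest by (simp add: dependency_graph_def D_def V_def)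

  have "\<exists>p. (\<forall>i. pmf p (Some i) = (if i \<in> I then x $ i else 0)) \<and> pmf p None = 1 - (\<Sum>i\<in>I. x $ i)"
    if I: "I \<in> \<I>" for I
  proof -
    let ?a = "\<lambda>i. if i \<in> I then x $ i else 0"
    have "sum ?a UNIV = (\<Sum>i\<in>I. x $ i)" by (simp add: sum.If_cases)
    moreover have "0 \<le> ?a i" for i using x0 IX[OF I] by auto
    ultimately show ?thesis using ex_pmf_option[of ?a] x1[OF I] by metis
  qed
  then obtain pX where pX: "\<And>I i. I \<in> \<I> \<Longrightarrow> pmf (pX I) (Some i) = (if i \<in> I then x $ i else 0)"
      "\<And>I. I \<in> \<I> \<Longrightarrow> pmf (pX I) None = 1 - (\<Sum>i\<in>I. x $ i)"
    by metis
  \<comment> \<open>A two-valued choice at \<open>j\<close> is encoded in \<open>'v option\<close>,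
    with no mass at \<open>Some k\<close> for other \<open>k\<close>, because the gluing lemma has a
    single state type for all nodes.\<close>
  have "\<exists>p. (\<forall>k. pmf p (Some k) = (if k = j then y $ j else 0)) \<and> pmf p None = 1 - y $ j"
    if j: "j \<in> Y" for j
  proof -
    let ?b = "\<lambda>k. if k = j then y $ j else 0"
    have "sum ?b UNIV = y $ j" by simp
    moreover have "0 \<le> ?b k" for k using y01 j by auto
    ultimately show ?thesis using ex_pmf_option[of ?b] y01[OF j] by metis
  qed
  then obtain pY where pY: "\<And>j k. j \<in> Y \<Longrightarrow> pmf (pY j) (Some k) = (if k = j then y $ j else 0)"
      "\<And>j. j \<in> Y \<Longrightarrow> pmf (pY j) None = 1 - y $ j"
    by metis
  define joint where "joint = (\<lambda>I j q. map_pmf fst q = pX I \<and> map_pmf snd q = pY j \<and>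
      (\<forall>i\<in>I. pmf q (Some i, Some j) = z $ {i, j}))"
  have "\<exists>q. joint I j q"
    if I: "I \<in> \<I>" and j: "j \<in> Y" and adj: "\<forall>i\<in>I. j \<in> nbrs E i" for I j
  proof -
    \<comment> \<open>Along an edge of the dependency graph the sums in the definition of
      \<open>H\<close> run over the whole block, as \<open>ex_joint_pmf\<close> requires.\<close>
    have full: "nbrs E j \<inter> I = I" using adj by (auto simp: nbrs_def insert_commute)
    have edge: "{i, j} \<in> E" "i \<in> X" if "i \<in> I" for i using adj IX[OF I] that by (auto simp: nbrs_def)
    let ?a = "\<lambda>i. if i \<in> I then x $ i else 0" and ?c = "\<lambda>i. if i \<in> I then z $ {i, j} else 0"
    have sums: "sum ?a UNIV = (\<Sum>i\<in>I. x $ i)" "sum ?c UNIV = (\<Sum>i\<in>I. z $ {i, j})"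
      by (simp_all add: sum.If_cases)
    obtain q where "map_pmf fst q = pX I" "map_pmf snd q = pY j"
        "\<And>i. pmf q (Some i, Some j) = ?c i"
    proof (rule ex_joint_pmf[of ?c ?a "y $ j" "pX I" "pY j" j])
      show "sum ?c UNIV \<le> y $ j" using zy[OF I j] by (simp only: sums full)
      show "y $ j + (\<Sum>i\<in>UNIV. ?a i - ?c i) \<le> 1"
        using xyz[OF I j] by (simp only: sum_subtractf sums full)
    qed (use z0 zx edge j I pX pY sums in auto)
    then show ?thesis by (auto simp: joint_def)
  qed
  then obtain r where "\<And>I j. I \<in> \<I> \<Longrightarrow> j \<in> Y \<Longrightarrow> \<forall>i\<in>I. j \<in> nbrs E i \<Longrightarrow> joint I j (r I j)"
    by metis
  then have
      r_fst: "\<And>I j. I \<in> \<I> \<Longrightarrow> j \<in> Y \<Longrightarrow> \<forall>i\<in>I. j \<in> nbrs E i \<Longrightarrow> map_pmf fst (r I j) = pX I"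
    and r_snd: "\<And>I j. I \<in> \<I> \<Longrightarrow> j \<in> Y \<Longrightarrow> \<forall>i\<in>I. j \<in> nbrs E i \<Longrightarrow> map_pmf snd (r I j) = pY j"
    and r_z: "\<And>I j i. I \<in> \<I> \<Longrightarrow> j \<in> Y \<Longrightarrow> \<forall>i\<in>I. j \<in> nbrs E i \<Longrightarrow> i \<in> I \<Longrightarrow>
                pmf (r I j) (Some i, Some j) = z $ {i, j}"
    unfolding joint_def by blast+

  define p where "p = (\<lambda>u. case u of Inl I \<Rightarrow> pX I | Inr j \<Rightarrow> pY j)"
  \<comment> \<open>Edges of \<open>D\<close> always join an \<open>Inl\<close> to an
    \<open>Inr\<close>, so the \<open>undefined\<close> cases never occur on an edge.\<close>
  define q where "q = (\<lambda>u v. case u of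
      Inl I \<Rightarrow> (case v of Inl _ \<Rightarrow> undefined | Inr j \<Rightarrow> r I j)
    | Inr j \<Rightarrow> (case v of Inl I \<Rightarrow> map_pmf prod.swap (r I j) | Inr _ \<Rightarrow> undefined))"
  have "\<exists>\<mu> :: ('v set + 'v \<Rightarrow> 'v option) pmf. (\<forall>v\<in>V. map_pmf (\<lambda>f. f v) \<mu> = p v) \<and>
          (\<forall>u\<in>V. \<forall>v\<in>V. {u, v} \<in> D \<longrightarrow> map_pmf (\<lambda>f. (f u, f v)) \<mu> = q u v)"
  proof (rule forest_joint_pmf)
    show "map_pmf fst (q u v) = p u" if "{u, v} \<in> D" for u v
      using D_cases[OF that] r_fst r_snd
      by (elim exE conjE disjE) (simp_all add: q_def p_def pmf.map_comp o_def)
    show "q v u = map_pmf prod.swap (q u v)" if "{u, v} \<in> D" for u v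
      using D_cases[OF that]
      by (elim exE conjE disjE) (simp_all add: q_def pmf.map_comp o_def pmf.map_ident)
    show "{v, v} \<notin> D" for v using D_cases by blast
  qed (use cf in \<open>simp_all add: V_def\<close>)
  then obtain \<mu> :: "('v set + 'v \<Rightarrow> 'v option) pmf" where
      \<mu>1: "\<And>v. v \<in> V \<Longrightarrow> map_pmf (\<lambda>f. f v) \<mu> = p v"
    and \<mu>2: "\<And>u v. u \<in> V \<Longrightarrow> v \<in> V \<Longrightarrow> {u, v} \<in> D \<Longrightarrow> map_pmf (\<lambda>f. (f u, f v)) \<mu> = q u v"
    by blast
  have \<mu>X: "map_pmf (\<lambda>f. f (Inl I)) \<mu> = pX I"
    if "I \<in> \<I>" for I
    using \<mu>1[of "Inl I"] that by (simp add: V_def p_def)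
  have \<mu>Y: "map_pmf (\<lambda>f. f (Inr j)) \<mu> = pY j" if "j \<in> Y" for j
    using \<mu>1[of "Inr j"] that by (simp add: V_def p_def)
  have \<mu>E: "map_pmf (\<lambda>f. (f (Inl I), f (Inr j))) \<mu> = r I j"
    if "I \<in> \<I>" "j \<in> Y" "\<forall>i\<in>I. j \<in> nbrs E i" for I j
  proof -
    have "{Inl I, Inr j} \<in> D" using that unfolding D_def by blast
    then show ?thesis using \<mu>2[of "Inl I" "Inr j"] that by (simp add: V_def q_def)
  qed

  \<comment> \<open>An outcome \<open>f\<close> is decoded into a 0/1 point. The guards
    \<open>i \<in> I\<close> and \<open>f (Inr j) = Some j\<close> discard meaningless values, so
    that every \<open>f\<close>, even one of probability zero, yields a generating point of
    \<open>P\<close>; each block contributes at most one node since \<open>f (Inl I)\<close> is a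
    single value.\<close>
  define chosen :: "('v set + 'v \<Rightarrow> 'v option) \<Rightarrow> 'v \<Rightarrow> bool"
    where "chosen = (\<lambda>f i. \<exists>I\<in>\<I>. i \<in> I \<and> f (Inl I) = Some i)"
  define active :: "('v set + 'v \<Rightarrow> 'v option) \<Rightarrow> 'v \<Rightarrow> bool"
    where "active = (\<lambda>f j. j \<in> Y \<and> f (Inr j) = Some j)"
  define both where "both = (\<lambda>f e. e \<in> E \<and> (\<exists>i\<in>X. \<exists>j\<in>Y. e = {i, j} \<and> chosen f i \<and> active f j))"
  define vx :: "_ \<Rightarrow> real ^ 'v" where "vx = (\<lambda>f. \<chi> i. of_bool (chosen f i))"
  define vy :: "_ \<Rightarrow> real ^ 'v" where "vy = (\<lambda>f. \<chi> j. of_bool (active f j))"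
  define vz :: "_ \<Rightarrow> real ^ 'v set" where "vz = (\<lambda>f. \<chi> e. of_bool (both f e))"
  have chosen_iff: "chosen f i \<longleftrightarrow> f (Inl I) = Some i" if "I \<in> \<I>" "i \<in> I" for f I i
    using that block_unique by (auto simp: chosen_def)
  \<comment> \<open>Disjointness of \<open>X\<close> and \<open>Y\<close> makes the endpoints
    recoverable from the unordered edge.\<close>
  have both_iff: "both f {i, j} \<longleftrightarrow> chosen f i \<and> active f j"
    if "i \<in> X" "j \<in> Y" "{i, j} \<in> E" for f i j
    using that disj by (auto simp: both_def doubleton_eq_iff)

  have vertex: "(vx f, vy f, vz f) \<in>
    {(x, y, z). x \<in> binary_on X \<and> y \<in> binary_on Y \<and> z \<in> binary_on E \<and>
        (\<forall>i\<in>X. \<forall>j\<in>Y. {i, j} \<in> E \<longrightarrow> x $ i * y $ j = z $ {i, j}) \<and>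
        x \<in> multiple_choice X \<I>}" for f
  proof -
    have "vx f \<in> binary_on X"
      using IX by (auto simp: binary_on_def vectors_on_def vx_def chosen_def)
    moreover have "vy f \<in> binary_on Y"
      by (auto simp: binary_on_def vectors_on_def vy_def active_def)
    moreover have "vz f \<in> binary_on E"
      by (auto simp: binary_on_def vectors_on_def vz_def both_def)
    moreover have "vx f $ i * vy f $ j = vz f $ {i, j}" if "i \<in> X" "j \<in> Y" "{i, j} \<in> E" for i j
      by (simp add: vx_def vy_def vz_def both_iff that)
    moreover have "(\<Sum>i\<in>I. vx f $ i) \<le> 1" if I: "I \<in> \<I>" for I
    proof -
      have "(\<Sum>i\<in>I. vx f $ i) = (\<Sum>i\<in>I. if Some i = f (Inl I) then 1 else 0)"
        using I by (intro sum.cong) (auto simp: vx_def chosen_iff)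
      also have "\<dots> \<le> 1" by (cases "f (Inl I)") auto
      finally show ?thesis .
    qed
    ultimately show ?thesis by (simp add: multiple_choice_def)
  qed

  have x_eq: "measure \<mu> {f. chosen f i} = x $ i" for i
  proof (cases "i \<in> X")
    case True
    then obtain I where I: "I \<in> \<I>" "i \<in> I" using block by blast
    have "measure \<mu> {f. chosen f i} = pmf (map_pmf (\<lambda>f. f (Inl I)) \<mu>) (Some i)"
      by (simp add: pmf_map vimage_def chosen_iff[OF I])
    then show ?thesis by (simp add: \<mu>X pX I)
  next
    case False
    then have "{f. chosen f i} = {}" using IX by (auto simp: chosen_def)
    then show ?thesis using False supp by simp
  qed
  have y_eq: "measure \<mu> {f. active f j} = y $ j" for j
  proof (cases "j \<in> Y")
    case True
    then have "measure \<mu> {f. active f j} = pmf (map_pmf (\<lambda>f. f (Inr j)) \<mu>) (Some j)"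
      by (simp add: pmf_map vimage_def active_def)
    then show ?thesis by (simp add: \<mu>Y pY True)
  next
    case False
    then show ?thesis using supp by (simp add: active_def)
  qed
  have z_eq: "measure \<mu> {f. both f e} = z $ e" for e
  proof (cases "e \<in> E")
    case True
    then obtain i j where ij: "i \<in> X" "j \<in> Y" "e = {i, j}" using edges by blast
    obtain I where I: "I \<in> \<I>" "i \<in> I" using block ij by blast
    have "j \<in> nbrs E i" using True ij by (simp add: nbrs_def)
    \<comment> \<open>Subset-uniformity spreads the adjacency from \<open>i\<close> to its whole
      block, so \<open>{Inl I, Inr j}\<close> is an edge of \<open>D\<close> and
      \<open>r I j\<close> describes the pair.\<close>
    then have adj: "\<forall>i\<in>I. j \<in> nbrs E i" using unif I unfolding subset_uniform_def by blast
    have "measure \<mu> {f. both f e} = pmf (map_pmf (\<lambda>f. (f (Inl I), f (Inr j))) \<mu>) (Some i, Some j)"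
      using True ij by (simp add: pmf_map vimage_def both_iff chosen_iff[OF I] active_def)
    then show ?thesis by (simp add: \<mu>E r_z adj I ij)
  next
    case False
    then show ?thesis using supp by (simp add: both_def)
  qed

  have expect_vec: "(\<Sum>f\<in>UNIV. pmf \<mu> f *\<^sub>R (\<chi> k. of_bool (P f k))) = w"
    if "\<And>k. measure \<mu> {f. P f k} = w $ k" for P and w :: "real ^ 'k"
    by (simp add: vec_eq_iff that sum_pmf_of_bool)
  \<comment> \<open>The outcomes form a finite function type, so the expectation is a finite convex
    combination with weights \<open>pmf \<mu> f\<close>; its coordinates are the probabilities
    computed in \<open>x_eq\<close>, \<open>y_eq\<close> and \<open>z_eq\<close>.\<close>
  have "(\<Sum>f\<in>UNIV. pmf \<mu> f *\<^sub>R (vx f, vy f, vz f)) = (x, y, z)"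
    unfolding vx_def vy_def vz_def
    by (simp add: sum_prod expect_vec x_eq y_eq z_eq)
  moreover have "(\<Sum>f\<in>UNIV. pmf \<mu> f *\<^sub>R (vx f, vy f, vz f)) \<in> P_polytope X Y E \<I>"
    unfolding P_polytope_def
    by (intro convex_sum convex_convex_hull hull_inc[OF vertex]) (simp_all add: sum_pmf_eq_1)
  ultimately show "(x, y, z) \<in> P_polytope X Y E \<I>" by simp
qed

theorem theorem3p5:
  fixes X Y :: "'v::finite set" and E \<I> :: "'v set set"
  assumes "bipartite_graph X Y E"
    and "partition_on X \<I>"
    and "subset_uniform E \<I>"
    and "cycle_free (dependency_graph Y E \<I>)"
  shows "H_polytope X Y E \<I> = P_polytope X Y E \<I>"
  using H_polytope_subset_P_polytope[OF assms] P_polytope_subset_H_polytope[OF assms(2)]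
  by (rule equalityI)

end
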